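(* Assume $\boldsymbol{b}\ne\boldsymbol{0}$ (at the time $t$ under consideration). Then $\tilde H_1$ has both positive and negative eigenvalues.
   Context: Let $A\in\mathbb{C}^{n\times n}$ and $\boldsymbol{b}=(b_1,\dots,b_n)\in\mathbb{C}^n$ (the values at a given time $t\in[0,T]$ of the coefficient matrix and source term of $\frac{\mathrm{d}}{\mathrm{d}t}\boldsymbol{u}=A(t)\boldsymbol{u}+\boldsymbol{b}(t)$). Let $B=\mathrm{diag}\{b_1,\dots,b_n\}$, $\tilde A=\begin{bmatrix}A&B\\O&O\end{bmatrix}\in\mathbb{C}^{2n\times2n}$, $H_1^A=(A+A^\dagger)/2$, and let $\tilde H_1=(\tilde A+\tilde A^\dagger)/2=\begin{bmatrix}H_1^A&\frac{B}{2}\\\frac{B^\dagger}{2}&O\end{bmatrix}$ be the Hermitian part of $\tilde A$. *)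

theory Defs
  imports "Jordan_Normal_Form.Schur_Decomposition"
begin

definition hermitian_part :: "complex mat \<Rightarrow> complex mat" where
  "hermitian_part M = (1 / 2) \<cdot>\<^sub>m (M + mat_adjoint M)"

definition diag_of_vec :: "complex vec \<Rightarrow> complex mat" where
  "diag_of_vec b = mat_diag (dim_vec b) (\<lambda>i. b $ i)"

(* The homogenised coefficient matrix of u' = A u + b; the intended arguments are
   A in carrier_mat n n and b in carrier_vec n. *)
definition augmented_mat :: "complex mat \<Rightarrow> complex vec \<Rightarrow> complex mat" where
  "augmented_mat A b =
    four_block_mat A (diag_of_vec b)
      (0\<^sub>m (dim_vec b) (dim_vec b)) (0\<^sub>m (dim_vec b) (dim_vec b))"

lemma dim_mat_adjoint [simp]:
  "dim_row (mat_adjoint A) = dim_col A" "dim_col (mat_adjoint A) = dim_row A"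
  by (auto simp: mat_adjoint_def)

lemma index_mat_adjoint [simp]:
  "i < dim_col A \<Longrightarrow> j < dim_row A \<Longrightarrow> mat_adjoint A $$ (i, j) = conjugate (A $$ (j, i))"
  by (auto simp: mat_adjoint_def mat_of_rows_def)

lemma hermitian_part_augmented_mat:
  assumes "A \<in> carrier_mat n n" and "b \<in> carrier_vec n"
  shows "hermitian_part (augmented_mat A b) =
    four_block_mat (hermitian_part A) ((1 / 2) \<cdot>\<^sub>m diag_of_vec b)
      ((1 / 2) \<cdot>\<^sub>m mat_adjoint (diag_of_vec b)) (0\<^sub>m n n)"
  using assms
  by (intro eq_matI)
     (auto simp: hermitian_part_def augmented_mat_def diag_of_vec_def mat_diag_def)

end

theory Submission
  imports Defs "Jordan_Normal_Form.Spectral_Radius"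
begin

text \<open>Let \<open>M\<close> be Hermitian with \<open>M\<^sub>j\<^sub>j = 0\<close> and \<open>M\<^sub>j\<^sub>i \<noteq> 0\<close>, and suppose that all its
  eigenvalues lie in \<open>[0, c]\<close>. For \<open>c < d\<close> the matrix \<open>H = (c I - M) / d\<close> has spectral radius below 1,
  so its powers are bounded. If \<open>d\<close> is close to \<open>c\<close>, then
  \<open>(H\<^sup>2)\<^sub>j\<^sub>j \<ge> (c\<^sup>2 + \<bar>M\<^sub>j\<^sub>i\<bar>\<^sup>2) / d\<^sup>2 > 1\<close>, and \<open>(N\<^sup>2)\<^sub>j\<^sub>j \<ge> \<bar>N\<^sub>j\<^sub>j\<bar>\<^sup>2\<close> for Hermitian
  \<open>N\<close> makes the \<open>(j, j)\<close> entry of \<open>H\<close> raised to the power \<open>2\<^sup>k\<close> grow without bound, a contradiction.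
  Hence \<open>M\<close> has a negative eigenvalue; applied to \<open>-M\<close>, this gives a positive one. The Hermitian part
  of the augmented matrix has the required shape because its lower right block vanishes while \<open>b \<noteq> 0\<close>.\<close>

definition hermitian_mat :: "nat \<Rightarrow> complex mat \<Rightarrow> bool" where
  "hermitian_mat n M \<longleftrightarrow> M \<in> carrier_mat n n \<and> mat_adjoint M = M"

lemma hermitian_matI:
  assumes "M \<in> carrier_mat n n"
    and "\<And>i j. i < n \<Longrightarrow> j < n \<Longrightarrow> cnj (M $$ (j, i)) = M $$ (i, j)"
  shows "hermitian_mat n M"
  unfolding hermitian_mat_def using assms by (auto intro!: eq_matI)

lemma hermitian_matD:
  assumes "hermitian_mat n M"
  shows "M \<in> carrier_mat n n"
    and "i < n \<Longrightarrow> j < n \<Longrightarrow> cnj (M $$ (j, i)) = M $$ (i, j)"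
proof -
  show M: "M \<in> carrier_mat n n" using assms by (simp add: hermitian_mat_def)
  assume "i < n" "j < n"
  then have "mat_adjoint M $$ (i, j) = cnj (M $$ (j, i))" using M by simp
  then show "cnj (M $$ (j, i)) = M $$ (i, j)" using assms by (simp add: hermitian_mat_def)
qed

lemma hermitian_mat_hermitian_part:
  assumes "A \<in> carrier_mat n n"
  shows "hermitian_mat n (hermitian_part A)"
  by (rule hermitian_matI) (use assms in \<open>auto simp: hermitian_part_def\<close>)

lemma hermitian_mat_uminus:
  assumes "hermitian_mat n M"
  shows "hermitian_mat n (- M)"
proof (rule hermitian_matI)
  note M = hermitian_matD[OF assms]
  show "- M \<in> carrier_mat n n" using M(1) by simp
  fix i j assume "i < n" "j < n"
  then show "cnj ((- M) $$ (j, i)) = (- M) $$ (i, j)" using M(1) M(2)[of i j] by simp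
qed

lemma index_mult_mat_sum:
  assumes "A \<in> carrier_mat n n" "B \<in> carrier_mat n n" "i < n" "j < n"
  shows "(A * B) $$ (i, j) = (\<Sum>l<n. A $$ (i, l) * B $$ (l, j))"
  using assms by (auto simp: scalar_prod_def atLeast0LessThan intro!: sum.cong)

lemma hermitian_mat_square:
  assumes "hermitian_mat n M"
  shows "hermitian_mat n (M * M)"
proof (rule hermitian_matI)
  note M = hermitian_matD[OF assms]
  show "M * M \<in> carrier_mat n n" using M(1) by simp
  fix i j assume "i < n" "j < n"
  then show "cnj ((M * M) $$ (j, i)) = (M * M) $$ (i, j)"
    by (auto simp: index_mult_mat_sum[OF M(1) M(1)] M(2) mult.commute intro!: sum.cong)
qed

text \<open>Since \<open>M $$ (l, j)\<close> is the conjugate of \<open>M $$ (j, l)\<close>,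
  squaring turns a diagonal entry into the squared norm of a row. Any part of that row then gives a
  lower bound.\<close>

lemma hermitian_mat_square_diag:
  assumes "hermitian_mat n M" "j < n"
  shows "(M * M) $$ (j, j) = of_real (\<Sum>l<n. (cmod (M $$ (j, l)))\<^sup>2)"
proof -
  note M = hermitian_matD[OF assms(1)]
  have "(M * M) $$ (j, j) = (\<Sum>l<n. M $$ (j, l) * cnj (M $$ (j, l)))"
    using assms(2) by (auto simp: index_mult_mat_sum[OF M(1) M(1)] M(2) intro!: sum.cong)
  then show ?thesis by (simp only: of_real_sum complex_norm_square)
qed

lemma eigenvalue_hermitian_real:
  assumes "hermitian_mat n M" "eigenvalue M k"
  shows "k \<in> \<real>"
proof -
  note M = hermitian_matD[OF assms(1)]
  obtain v where v: "v \<in> carrier_vec n" "v \<noteq> 0\<^sub>v n" and Mv: "M *\<^sub>v v = k \<cdot>\<^sub>v v"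
    using assms(2) M(1) by (auto simp: eigenvalue_def eigenvector_def)
  have row: "(\<Sum>l<n. M $$ (i, l) * v $ l) = k * v $ i" if "i < n" for i
  proof -
    have "(M *\<^sub>v v) $ i = (\<Sum>l<n. M $$ (i, l) * v $ l)"
      using that M(1) v(1) by (auto simp: scalar_prod_def atLeast0LessThan intro!: sum.cong)
    with that v(1) show ?thesis by (simp add: Mv)
  qed
  \<comment> \<open>The quadratic form v* M v is evaluated twice: the eigenvalue equation gives k
    times the squared norm of v, while conjugating and swapping the sums shows that it is
    real.\<close>
  define q where "q = (\<Sum>i<n. \<Sum>l<n. cnj (v $ i) * (M $$ (i, l) * v $ l))"
  define s where "s = (\<Sum>i<n. (cmod (v $ i))\<^sup>2)"
  have "q = (\<Sum>i<n. cnj (v $ i) * (k * v $ i))"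
    unfolding q_def by (intro sum.cong refl) (simp add: row flip: sum_distrib_left)
  also have "\<dots> = k * of_real s"
    by (simp add: s_def complex_norm_square sum_distrib_left mult_ac del: of_real_power)
  finally have q: "q = k * of_real s" .
  have "cnj q = (\<Sum>i<n. \<Sum>l<n. cnj (v $ l) * (M $$ (l, i) * v $ i))"
    unfolding q_def cnj_sum
    by (intro sum.cong refl) (use M(2) in \<open>simp add: mult_ac\<close>)
  also have "\<dots> = q" unfolding q_def by (rule sum.swap)
  finally have "cnj q = q" .
  moreover have "s \<noteq> 0"
  proof
    assume "s = 0"
    then have "\<forall>i<n. v $ i = 0" by (auto simp: s_def sum_nonneg_eq_0_iff)
    then have "v = 0\<^sub>v n" using v(1) by (intro eq_vecI) auto
    with v(2) show False by contradiction
  qed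
  ultimately have "cnj k = k" by (simp add: q)
  then show ?thesis by (simp add: Reals_cnj_iff)
qed

lemma pow_mat_add:
  assumes "A \<in> carrier_mat n n"
  shows "A ^\<^sub>m (k + l) = A ^\<^sub>m k * A ^\<^sub>m l"
proof (induction l)
  case 0
  show ?case using assms by simp
next
  case (Suc l)
  have "A ^\<^sub>m k * A ^\<^sub>m l * A = A ^\<^sub>m k * (A ^\<^sub>m l * A)"
    using assms by (intro assoc_mult_mat) auto
  with Suc show ?case by simp
qed

lemma spectral_radius_hermitian_ge_1:
  assumes H: "hermitian_mat n H" and j: "j < n" and gt: "cmod ((H * H) $$ (j, j)) > 1"
  shows "spectral_radius H \<ge> 1"
proof (rule ccontr)
  assume "\<not> spectral_radius H \<ge> 1"
  have C: "H \<in> carrier_mat n n" using H by (rule hermitian_matD)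
  \<comment> \<open>One constant bounds every entry of every power, by the Jordan normal
    form.\<close>
  have "\<exists>c. \<forall>k. norm_bound (H ^\<^sub>m k) c"
    by (rule spectral_radius_jnf_norm_bound_less_1_upper_triangular[OF C])
       (use \<open>\<not> spectral_radius H \<ge> 1\<close> in simp)
  then obtain c where "\<And>k. norm_bound (H ^\<^sub>m k) c" by blast
  then have c: "cmod ((H ^\<^sub>m k) $$ (j, j)) \<le> c" for k
    using C j by (auto simp: norm_bound_def)
  define q where "q = cmod ((H * H) $$ (j, j))"
  have double: "H ^\<^sub>m (2 * m) = H ^\<^sub>m m * H ^\<^sub>m m" for m
    using pow_mat_add[OF C, of m m] by (simp add: mult_2)
  have herm: "hermitian_mat n (H ^\<^sub>m (2 ^ k))" for k
  proof (induction k)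
    case 0
    show ?case using H C by simp
  next
    case (Suc k)
    then show ?case by (simp add: double hermitian_mat_square)
  qed
  \<comment> \<open>The exponent on the right is one doubling ahead because \<open>q\<close> is
    already an entry of the square of \<open>H\<close>. Each further squaring keeps only the summand
    l = j of the row norm.\<close>
  have grow: "q ^ (2 ^ k) \<le> cmod ((H ^\<^sub>m (2 ^ Suc k)) $$ (j, j))" for k
  proof (induction k)
    case 0
    show ?case using C by (simp add: q_def numeral_2_eq_2)
  next
    case (Suc k)
    let ?N = "H ^\<^sub>m (2 ^ Suc k)"
    have "q ^ (2 ^ Suc k) = (q ^ (2 ^ k))\<^sup>2" by (simp add: power_even_eq)
    also have "\<dots> \<le> (cmod (?N $$ (j, j)))\<^sup>2"
      by (rule power_mono[OF Suc]) (simp add: q_def)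
    also have "\<dots> \<le> (\<Sum>l<n. (cmod (?N $$ (j, l)))\<^sup>2)"
      by (rule member_le_sum) (use j in auto)
    also have "\<dots> = cmod ((?N * ?N) $$ (j, j))"
      by (simp only: hermitian_mat_square_diag[OF herm j] norm_of_real) (simp add: sum_nonneg)
    also have "?N * ?N = H ^\<^sub>m (2 ^ Suc (Suc k))"
      by (simp only: power_Suc[of 2 "Suc k"] double)
    finally show ?case .
  qed
  \<comment> \<open>The bound holds only at exponents that are powers of two, so m \<le> 2^m carries
    the Archimedean choice over to one of them.\<close>
  obtain m where "c < q ^ m" using real_arch_pow[of q c] gt by (auto simp: q_def)
  also have "q ^ m \<le> q ^ (2 ^ m)"
    using gt by (intro power_increasing) (auto simp: q_def less_imp_le)
  also have "\<dots> \<le> c" using grow[of m] c[of "2 ^ Suc m"] by linarith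
  finally show False by simp
qed

lemma smult_mat_mult_vec:
  fixes A :: "'a::comm_ring_1 mat"
  assumes "A \<in> carrier_mat m n" "v \<in> carrier_vec n"
  shows "(a \<cdot>\<^sub>m A) *\<^sub>v v = a \<cdot>\<^sub>v (A *\<^sub>v v)"
  by (rule eq_vecI) (use assms in \<open>auto simp: scalar_prod_def sum_distrib_left mult.assoc\<close>)

lemma hermitian_negative_eigenvalue:
  assumes M: "hermitian_mat n M" and i: "i < n" and j: "j < n"
    and diag: "M $$ (j, j) = 0" and off: "M $$ (j, i) \<noteq> 0"
  shows "\<exists>s::real. s < 0 \<and> eigenvalue M (complex_of_real s)"
proof (rule ccontr)
  assume "\<not> ?thesis"
  then have nonneg: "s \<ge> 0" if "eigenvalue M (complex_of_real s)" for s
    using that by force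
  note C = hermitian_matD(1)[OF M]
  define c where "c = spectral_radius M"
  have le_c: "cmod k \<le> c" if "eigenvalue M k" for k
    using spectral_radius_mem_max(2)[OF C, of "cmod k"] j that by (auto simp: c_def spectrum_def)
  \<comment> \<open>Some eigenvalue exists because the dimension is positive; its modulus forces c
    \<ge> 0.\<close>
  obtain k where "eigenvalue M k"
    using spectrum_non_empty[OF C] j by (auto simp: spectrum_def)
  with le_c[of k] have c0: "c \<ge> 0" using norm_ge_zero[of k] by linarith
  \<comment> \<open>The factor 1/2 puts \<open>d\<close> squared strictly between c^2 and c^2 +
    |M_ji|^2: the first inequality gives c < d, the second makes the diagonal entry of
    \<open>H * H\<close> exceed 1.\<close>
  define d where "d = sqrt (c\<^sup>2 + (cmod (M $$ (j, i)))\<^sup>2 / 2)"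
  have d2: "d\<^sup>2 = c\<^sup>2 + (cmod (M $$ (j, i)))\<^sup>2 / 2" by (simp add: d_def)
  have cd: "c < d" unfolding d_def using off by (intro real_less_rsqrt) simp
  define H where "H = mat n n (\<lambda>(k, l). ((if k = l then of_real c else 0) - M $$ (k, l)) / of_real d)"
  have HC: "H \<in> carrier_mat n n" by (simp add: H_def)
  have herm: "hermitian_mat n H"
    by (rule hermitian_matI) (use hermitian_matD(2)[OF M] in \<open>auto simp: H_def\<close>)
  have "cmod ((H * H) $$ (j, j)) > 1"
  proof -
    have ij: "i \<noteq> j" using diag off by auto
    have "0 < (cmod (M $$ (j, i)))\<^sup>2" using off by simp
    then have "d\<^sup>2 < c\<^sup>2 + (cmod (M $$ (j, i)))\<^sup>2" using d2 by linarith
    then have "1 < (c\<^sup>2 + (cmod (M $$ (j, i)))\<^sup>2) / d\<^sup>2"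
      using cd c0 by (simp add: less_divide_eq)
    \<comment> \<open>Row j of \<open>H\<close> has the entry c/d in column j, as M_jj = 0, and
      -M_ji/d in column i, which is a different column.\<close>
    also have "\<dots> = (\<Sum>l\<in>{i, j}. (cmod (H $$ (j, l)))\<^sup>2)"
      using i j ij diag c0 cd by (simp add: H_def norm_divide power_divide add_divide_distrib)
    also have "\<dots> \<le> (\<Sum>l<n. (cmod (H $$ (j, l)))\<^sup>2)"
      by (rule sum_mono2) (use i j in auto)
    also have "\<dots> = cmod ((H * H) $$ (j, j))"
      by (simp only: hermitian_mat_square_diag[OF herm j] norm_of_real) (simp add: sum_nonneg)
    finally show ?thesis .
  qed
  then have "spectral_radius H \<ge> 1" by (rule spectral_radius_hermitian_ge_1[OF herm j])
  moreover obtain \<mu> where \<mu>: "eigenvalue H \<mu>" "spectral_radius H = cmod \<mu>"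
    using spectral_radius_mem_max(1)[OF HC] j by (auto simp: spectrum_def)
  ultimately have \<mu>1: "cmod \<mu> \<ge> 1" by simp
  obtain v where v: "v \<in> carrier_vec n" "v \<noteq> 0\<^sub>v n" and Hv: "H *\<^sub>v v = \<mu> \<cdot>\<^sub>v v"
    using \<mu>(1) HC by (auto simp: eigenvalue_def eigenvector_def)
  \<comment> \<open>Solving the definition of \<open>H\<close> for \<open>M\<close> turns an
    eigenvector of \<open>H\<close> for \<mu> into one of \<open>M\<close> for c - d\<mu>.\<close>
  have M_eq: "M = of_real c \<cdot>\<^sub>m 1\<^sub>m n + (- of_real d) \<cdot>\<^sub>m H"
    by (rule eq_matI) (use C cd c0 in \<open>auto simp: H_def\<close>)
  have "M *\<^sub>v v = (of_real c - of_real d * \<mu>) \<cdot>\<^sub>v v"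
    unfolding M_eq using v(1) HC
    by (subst add_mult_distrib_mat_vec[of _ n n])
       (auto simp: smult_mat_mult_vec[of _ n n] Hv algebra_simps intro!: eq_vecI)
  then have ev: "eigenvalue M (of_real c - of_real d * \<mu>)"
    using v C unfolding eigenvalue_def eigenvector_def by (intro exI[of _ v]) simp
  obtain r where "\<mu> = of_real r" using eigenvalue_hermitian_real[OF herm \<mu>(1)] by (auto elim: Reals_cases)
  with ev have ev': "eigenvalue M (complex_of_real (c - d * r))" by simp
  \<comment> \<open>As c - dr lies in [0, c], r lies in [0, c/d], hence below 1, against |r| \<ge>
    1.\<close>
  have "0 \<le> c - d * r" by (rule nonneg[OF ev'])
  moreover have "c - d * r \<le> c" using le_c[OF ev'] unfolding norm_of_real by linarith
  ultimately have "0 \<le> r" "d * r \<le> c" using cd c0 by (auto simp: zero_le_mult_iff)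
  moreover have "\<bar>r\<bar> \<ge> 1" using \<mu>1 \<open>\<mu> = of_real r\<close> by simp
  ultimately have "d * 1 \<le> d * r" using cd c0 by (intro mult_left_mono) auto
  with \<open>d * r \<le> c\<close> cd show False by simp
qed

lemma eigenvalue_uminus:
  fixes M :: "complex mat"
  assumes "M \<in> carrier_mat n n" "eigenvalue (- M) k"
  shows "eigenvalue M (- k)"
proof -
  obtain v where v: "v \<in> carrier_vec n" "v \<noteq> 0\<^sub>v n" and "- M *\<^sub>v v = k \<cdot>\<^sub>v v"
    using assms by (auto simp: eigenvalue_def eigenvector_def)
  then have "- (M *\<^sub>v v) = k \<cdot>\<^sub>v v" using assms(1) by (simp add: uminus_mult_mat_vec)
  then have "M *\<^sub>v v = - (k \<cdot>\<^sub>v v)" using assms(1) by (metis uminus_uminus_vec)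
  then have "M *\<^sub>v v = (- k) \<cdot>\<^sub>v v" using v(1) by (auto intro!: eq_vecI)
  with v assms(1) show ?thesis unfolding eigenvalue_def eigenvector_def by auto
qed

theorem lemma5p1:
  fixes A :: "complex mat" and b :: "complex vec" and n :: nat
  assumes "A \<in> carrier_mat n n"
    and "b \<in> carrier_vec n"
    and "b \<noteq> 0\<^sub>v n"
  shows "(\<exists>r::real. r > 0 \<and> eigenvalue (hermitian_part (augmented_mat A b)) (complex_of_real r)) \<and>
         (\<exists>s::real. s < 0 \<and> eigenvalue (hermitian_part (augmented_mat A b)) (complex_of_real s))"
proof -
  let ?H = "hermitian_part (augmented_mat A b)"
  obtain k where k: "k < n" "b $ k \<noteq> 0"
    using assms(2,3) by (metis carrier_vecD eq_vecI index_zero_vec)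
  have "augmented_mat A b \<in> carrier_mat (n + n) (n + n)"
    using assms(1,2) by (auto simp: augmented_mat_def diag_of_vec_def)
  then have H: "hermitian_mat (n + n) ?H" by (rule hermitian_mat_hermitian_part)
  note C = hermitian_matD(1)[OF H]
  \<comment> \<open>Row n + k meets the zero block on the diagonal and has the entry cnj(b_k)/2 in
    column k.\<close>
  have bounds: "k < n + n" "n + k < n + n" using k(1) by auto
  have diag: "?H $$ (n + k, n + k) = 0" and off: "?H $$ (n + k, k) \<noteq> 0"
    using assms(1,2) k
    by (auto simp: hermitian_part_def augmented_mat_def diag_of_vec_def mat_diag_def)
  \<comment> \<open>Negation preserves both the zero diagonal entry and the nonzero off-diagonal
    one.\<close>
  have "\<exists>s::real. s < 0 \<and> eigenvalue (- ?H) (complex_of_real s)"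
    by (rule hermitian_negative_eigenvalue[OF hermitian_mat_uminus[OF H] bounds])
       (use C bounds diag off in auto)
  then obtain s :: real where "s < 0" "eigenvalue (- ?H) (complex_of_real s)" by blast
  then have "- s > 0" "eigenvalue ?H (complex_of_real (- s))"
    using eigenvalue_uminus[OF C] by auto
  moreover have "\<exists>s::real. s < 0 \<and> eigenvalue ?H (complex_of_real s)"
    by (rule hermitian_negative_eigenvalue[OF H bounds diag off])
  ultimately show ?thesis by blast
qed

end
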